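(* For every integer $n\geq 3$, $$sn(C_n\circ K_1)=\begin{cases}1, & \text{if } n \text{ is even},\\ n+1, & \text{if } n \text{ is odd}.\end{cases}$$
   Context: All graphs are finite, undirected, simple and connected. $\chi(G)$ is the chromatic number. $C_n$ is the cycle on $n$ vertices. Sudoku number: let $\chi(G)=k$ and fix the set of $k$ colors $\{1,\dots,k\}$. For $S\subset V(G)$ let $C_0$ be a proper coloring of the induced subgraph $G[S]$ with colors from these $k$ colors (at most $k$ colors are used). $C_0$ is called extendable if it can be extended to a proper coloring of $G$ with these $k$ colors, and it is a Sudoku coloring of $G$ if this extension exists and is unique. The Sudoku number $sn(G)$ is the smallest $|S|$ such that $G[S]$ admits a Sudoku coloring. Corona product: $G\circ H$ is obtained from one copy of $G$ and $|V(G)|$ disjoint copies of $H$ by joining the $i$-th vertex of $G$ to every vertex of the $i$-th copy of $H$. *)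

theory Defs
  imports "Graph_Theory.Graph_Theory" "HOL-Library.FuncSet"
begin

text \<open>
  Graphs are rendered as in \<^verbatim>\<open>Graph_Theory\<close>: a simple undirected graph is a
  symmetric loop-free digraph, so each edge is represented by two opposite arcs.
  Colorings are taken in the extensional function space (undefined outside the vertex
  set), so that distinct functions are distinct colorings and
  unique existence counts colorings, not their representatives.
\<close>

definition proper_coloring :: "('a, 'b) pre_digraph \<Rightarrow> nat \<Rightarrow> ('a \<Rightarrow> nat) \<Rightarrow> bool" where
  "proper_coloring G k c \<longleftrightarrow>
     c \<in> verts G \<rightarrow>\<^sub>E {1..k} \<and> (\<forall>(u, v) \<in> arcs_ends G. c u \<noteq> c v)"

text \<open>Meaningful for finite loop-free graphs, where some proper coloring exists.\<close>

definition chromatic_number :: "('a, 'b) pre_digraph \<Rightarrow> nat" where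
  "chromatic_number G = (LEAST k. \<exists>c. proper_coloring G k c)"

definition extension :: "('a, 'b) pre_digraph \<Rightarrow> 'a set \<Rightarrow> ('a \<Rightarrow> nat) \<Rightarrow> ('a \<Rightarrow> nat) \<Rightarrow> bool" where
  "extension G S c0 c \<longleftrightarrow>
     proper_coloring G (chromatic_number G) c \<and> (\<forall>v \<in> S. c v = c0 v)"

definition sudoku_coloring :: "('a, 'b) pre_digraph \<Rightarrow> 'a set \<Rightarrow> ('a \<Rightarrow> nat) \<Rightarrow> bool" where
  "sudoku_coloring G S c0 \<longleftrightarrow>
     proper_coloring (G \<restriction> S) (chromatic_number G) c0 \<and> (\<exists>!c. extension G S c0 c)"

text \<open>For finite loop-free \<open>G\<close> the minimum is attained, since \<open>S = verts G\<close> qualifies.\<close>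

definition sudoku_number :: "('a, 'b) pre_digraph \<Rightarrow> nat" where
  "sudoku_number G =
     (LEAST m. \<exists>S \<subseteq> verts G. card S = m \<and> (\<exists>c0. sudoku_coloring G S c0))"

text \<open>The vertices are \<open>0, \<dots>, n - 1\<close>; this is the cycle on \<open>n\<close> vertices for \<open>n \<ge> 3\<close>.\<close>

definition cycle_graph :: "nat \<Rightarrow> nat pair_pre_digraph" where
  "cycle_graph n =
     \<lparr> pverts = {0..<n},
       parcs = {(i, j). i < n \<and> j < n \<and> (j = Suc i mod n \<or> i = Suc j mod n)} \<rparr>"

definition complete_graph :: "nat \<Rightarrow> nat pair_pre_digraph" where
  "complete_graph n =
     \<lparr> pverts = {0..<n}, parcs = {(i, j). i < n \<and> j < n \<and> i \<noteq> j} \<rparr>"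

text \<open>\<open>Inl v\<close> is the vertex \<open>v\<close> of \<open>G\<close>; \<open>Inr (v, x)\<close> is the vertex \<open>x\<close> in the copy of \<open>H\<close> belonging to \<open>v\<close>.\<close>

definition corona ::
    "'a pair_pre_digraph \<Rightarrow> 'b pair_pre_digraph \<Rightarrow> ('a + 'a \<times> 'b) pair_pre_digraph" where
  "corona G H =
     \<lparr> pverts = Inl ` pverts G \<union> Inr ` (pverts G \<times> pverts H),
       parcs = {(Inl u, Inl v) | u v. (u, v) \<in> parcs G}
             \<union> {(Inr (v, x), Inr (v, y)) | v x y. v \<in> pverts G \<and> (x, y) \<in> parcs H}
             \<union> {(Inl v, Inr (v, x)) | v x. v \<in> pverts G \<and> x \<in> pverts H}
             \<union> {(Inr (v, x), Inl v) | v x. v \<in> pverts G \<and> x \<in> pverts H} \<rparr>"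

lemma pair_graphI:
  assumes "finite (pverts G)" "parcs G \<subseteq> pverts G \<times> pverts G" "sym (parcs G)" "irrefl (parcs G)"
  shows "pair_graph G"
proof -
  have "finite (parcs G)"
    using assms(1,2) by (meson finite_SigmaI finite_subset)
  then show ?thesis
    using assms by unfold_locales (auto simp: symmetric_def irrefl_def)
qed

lemma pair_graph_cycle_graph:
  assumes "n \<ge> 3"
  shows "pair_graph (cycle_graph n)"
proof (rule pair_graphI)
  have "i \<noteq> Suc i mod n" if "i < n" for i
    using that assms by (cases "Suc i = n") auto
  then show "irrefl (parcs (cycle_graph n))"
    by (auto simp: cycle_graph_def irrefl_def)
qed (auto simp: cycle_graph_def sym_def)

lemma pair_graph_complete_graph: "pair_graph (complete_graph n)"
  by (rule pair_graphI) (auto simp: complete_graph_def sym_def irrefl_def)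

lemma complete_digraph_complete_graph: "K\<^bsub>n\<^esub> (complete_graph n)"
  by (auto simp: complete_digraph_pair_def complete_graph_def)

lemma pair_graph_corona:
  assumes "pair_graph G" "pair_graph H"
  shows "pair_graph (corona G H)"
proof (rule pair_graphI)
  interpret G: pair_graph G by fact
  interpret H: pair_graph H by fact
  show "finite (pverts (corona G H))"
    by (simp add: corona_def G.pair_finite_verts H.pair_finite_verts)
  show "parcs (corona G H) \<subseteq> pverts (corona G H) \<times> pverts (corona G H)"
    by (auto simp: corona_def dest: G.wellformed' H.wellformed')
  show "sym (parcs (corona G H))"
    using G.pair_sym_arcs H.pair_sym_arcs by (auto simp: corona_def symmetric_def sym_def)
  show "irrefl (parcs (corona G H))"
    by (auto simp: corona_def irrefl_def dest: G.pair_no_loops H.pair_no_loops)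
qed

end

theory Submission
  imports Defs "HOL-Library.Periodic_Fun"
begin

text \<open>
  If \<open>n\<close> is even, the corona is connected and bipartite with chromatic number 2: one colored
  vertex determines the coloring, and the empty coloring has two extensions. If \<open>n\<close> is odd, the
  chromatic number is 3. A pendant vertex outside \<open>S\<close> has two available colors, so \<open>S\<close> contains
  all pendant vertices; if it contains nothing else, the extensions are the colorings of the odd
  cycle from lists of size 2, and there is never exactly one of those. Conversely, if the
  pendant vertices leave at each cycle vertex \<open>i\<close> only the colors of \<open>i\<close> and of its predecessor,
  then the color of the vertex 0 forces all others.
\<close>

section \<open>List colorings of odd cycles\<close>

text \<open>Functions on the cycle are modelled as functions on \<open>int\<close> of period
  \<open>n\<close>, so that \<open>i - 1\<close> and \<open>i + 1\<close> need no wrap-around. This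
  lemma leads back to representatives modulo the period.\<close>

lemma periodic_mod:
  fixes f :: "int \<Rightarrow> 'a"
  assumes "\<And>i. f (i + p) = f i"
  shows "f (i mod p) = f i"
proof -
  interpret periodic_fun_simple f p by unfold_locales (rule assms)
  have "f i = f (i mod p + of_int (i div p) * p)" by simp
  also have "\<dots> = f (i mod p)" by (rule plus_of_int)
  finally show ?thesis by simp
qed

lemma periodic_mod_shift:
  fixes f :: "int \<Rightarrow> 'a"
  assumes "\<And>i. f (i + p) = f i"
  shows "f (a + (i - a) mod p) = f i"
  using periodic_mod[of "\<lambda>i. f (a + i)" p "i - a"] assms by (simp add: add.assoc[symmetric])

text \<open>
  Here \<open>c\<close> is a coloring of the cycle and \<open>d i\<close> is the other color in the list of \<open>i\<close>. The
  proof switches from \<open>c\<close> to \<open>d\<close> on an interval that starts at a vertex \<open>a\<close> where this makes no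
  conflict with \<open>a - 1\<close>, and that grows until the conflict with the next vertex disappears.
\<close>

lemma odd_cycle_not_unique_2_list_coloring:
  fixes c d :: "int \<Rightarrow> 'a" and n :: nat
  assumes n: "odd n"
    and pc: "\<And>i. c (i + int n) = c i" and pd: "\<And>i. d (i + int n) = d i"
    and proper: "\<And>i. c i \<noteq> c (i + 1)" and cd: "\<And>i. c i \<noteq> d i"
  shows "\<exists>e. e \<noteq> c \<and> (\<forall>i. e (i + int n) = e i) \<and> (\<forall>i. e i \<in> {c i, d i}) \<and>
           (\<forall>i. e i \<noteq> e (i + 1))"
proof (rule ccontr)
  assume "\<not> ?thesis"
  then have uniq: "e = c" if "\<And>i. e (i + int n) = e i" "\<And>i. e i \<in> {c i, d i}"
      "\<And>i. e i \<noteq> e (i + 1)" for e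
    using that by blast
  have n0: "n > 0" using n by (rule odd_pos)
  \<comment> \<open>Under uniqueness the switched interval can never stop: each switched vertex
    clashes with its unswitched successor. The bound on \<open>k\<close> keeps \<open>a - 1\<close>
    unswitched, so the assumption on \<open>a\<close> settles the edge from \<open>a - 1\<close> to
    \<open>a\<close>.\<close>
  have chain: "d (a + int k) = c (a + int k + 1)"
    if a: "d a \<noteq> c (a - 1)" and k: "k < n - 1" for a k
  proof (rule ccontr)
    define P where "P k \<longleftrightarrow> d (a + int k) \<noteq> c (a + int k + 1)" for k
    define b where "b = (LEAST k. P k)"
    assume "d (a + int k) \<noteq> c (a + int k + 1)"
    then have "P k" by (simp add: P_def)
    then have Pb: "P b" and "b \<le> k" unfolding b_def by (rule LeastI, rule Least_le)
    then have b: "b < n - 1" using k by simp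
    \<comment> \<open>Before \<open>b\<close>, the new color of a vertex is the old color of the
      next one, hence not its new color: switched neighbors do not clash.\<close>
    have less: "d (a + int j) = c (a + int j + 1)" if "j < b" for j
      using not_less_Least[of j P] that by (auto simp: b_def P_def)
    define e where "e i = (if (i - a) mod int n \<le> int b then d i else c i)" for i
    have "e i \<noteq> e (i + 1)" for i
    proof -
      define r where "r = nat ((i - a) mod int n)"
      have r: "int r = (i - a) mod int n" "r < n"
        using n0 by (auto simp: r_def nat_less_iff)
      have ci: "c i = c (a + int r)" and di: "d i = d (a + int r)"
        using periodic_mod_shift[of c "int n" a i] periodic_mod_shift[of d "int n" a i] pc pd r(1)
        by simp_all
      have ci1: "c (i + 1) = c (a + int r + 1)" and di1: "d (i + 1) = d (a + int r + 1)"
        using periodic_mod_shift[of "\<lambda>i. c (i + 1)" "int n" a i]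
          periodic_mod_shift[of "\<lambda>i. d (i + 1)" "int n" a i] pc pd r(1)
        by (simp_all add: algebra_simps) (metis add.assoc add.commute)+
      have step: "(i + 1 - a) mod int n = (int r + 1) mod int n"
        unfolding r(1) by (simp add: mod_simps algebra_simps)
      consider "r = n - 1" | "r < n - 1" using r by linarith
      then show ?thesis
      proof cases
        case 1
        have s: "a + int r = a - 1 + int n" "a + int r + 1 = a + int n"
          using 1 n0 by auto
        have "(int r + 1) mod int n = 0" using 1 n0 by simp
        then have "e (i + 1) = d (a + int r + 1)" using step by (simp add: e_def di1)
        moreover have "e i = c (a + int r)" using 1 b n0 ci by (auto simp: e_def simp flip: r(1))
        ultimately show ?thesis using a unfolding s pc by (simp add: pd)
      next
        case 2
        then have "(int r + 1) mod int n = int r + 1" by simp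
        then have e1: "e (i + 1) = (if r < b then d (a + int r + 1) else c (a + int r + 1))"
          using step by (simp add: e_def di1 ci1)
        have e0: "e i = (if r \<le> b then d (a + int r) else c (a + int r))"
          by (simp add: e_def di ci flip: r(1))
        consider "r < b" | "r = b" | "r > b" by linarith
        then show ?thesis
        proof cases
          case 1
          then show ?thesis using e0 e1 less[of r] cd[of "a + int r + 1"] by simp
        next
          case 2
          then show ?thesis using e0 e1 Pb by (simp add: P_def)
        next
          case 3
          then show ?thesis using e0 e1 proper[of "a + int r"] by simp
        qed
      qed
    qed
    moreover have "(i + int n - a) mod int n = (i - a) mod int n" for i
      by (metis add_diff_eq add.commute diff_add_eq mod_add_self2)
    then have "e (i + int n) = e i" for i by (simp add: e_def pc pd)
    ultimately have "e = c" by (intro uniq) (auto simp: e_def)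
    then have "e a = c a" by simp
    then show False using cd[of a] by (simp add: e_def)
  qed
  \<comment> \<open>Since \<open>d\<close> differs from \<open>c\<close>, uniqueness forbids that
    \<open>d\<close> is proper.\<close>
  have all_d: "\<exists>i. d i = d (i + 1)"
    using uniq[of d] pd cd by (metis insertCI)
  \<comment> \<open>Otherwise \<open>d\<close> is \<open>c\<close> shifted by one vertex and
    therefore proper.\<close>
  have "\<exists>a. d a \<noteq> c (a - 1)"
  proof (rule ccontr)
    assume "\<nexists>a. d a \<noteq> c (a - 1)"
    then have "d i = c (i - 1)" for i by blast
    then show False using all_d proper by (metis diff_add_cancel add_diff_cancel)
  qed
  then obtain a where a: "d a \<noteq> c (a - 1)" by blast
  \<comment> \<open>By \<open>chain\<close>, \<open>d\<close> is proper along the path from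
    \<open>x\<close> to \<open>x + n - 1\<close>, so its monochromatic edge is the one remaining
    edge of the cycle.\<close>
  have closing: "d (x - 1) = d x" if x: "d x \<noteq> c (x - 1)" for x
  proof -
    obtain i where i: "d i = d (i + 1)" using all_d by blast
    define r where "r = nat ((i - x) mod int n)"
    have r: "int r = (i - x) mod int n" "r < n"
      using n0 by (auto simp: r_def nat_less_iff)
    have di: "d i = d (x + int r)" using periodic_mod_shift[of d "int n" x i] pd r(1) by simp
    have di1: "d (i + 1) = d (x + int r + 1)"
      using periodic_mod_shift[of "\<lambda>i. d (i + 1)" "int n" x i] pd r(1)
      by (simp add: algebra_simps) (metis add.assoc add.commute)
    have "r = n - 1"
    proof (rule ccontr)
      assume "r \<noteq> n - 1"
      then have "r < n - 1" using r by simp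
      then show False using chain[OF x, of r] cd[of "x + int r + 1"] i di di1 by simp
    qed
    then have s: "x + int r = x - 1 + int n" "x + int r + 1 = x + int n" using n0 by auto
    show ?thesis using i di di1 unfolding s pd by (simp add: pd)
  qed
  \<comment> \<open>If this failed, \<open>closing\<close> would apply at \<open>a + k + 1\<close>
    and give a monochromatic edge of \<open>d\<close> where \<open>chain\<close> excludes
    one.\<close>
  have backward: "d (a + int k + 1) = c (a + int k)" if "k < n - 1" for k
  proof (rule ccontr)
    assume "d (a + int k + 1) \<noteq> c (a + int k)"
    then have "d (a + int k) = d (a + int k + 1)" using closing[of "a + int k + 1"] by simp
    then show False using chain[OF a that] cd[of "a + int k + 1"] by simp
  qed
  \<comment> \<open>Both \<open>c (a + 2k)\<close> and \<open>c (a + 2k + 2)\<close> equal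
    \<open>d (a + 2k + 1)\<close>. As \<open>n - 1\<close> is even, the color of \<open>a\<close> is
    carried to its neighbor \<open>a + n - 1\<close>, a contradiction.\<close>
  have "c (a + int (2 * k)) = c a" if "2 * k \<le> n - 1" for k
    using that
  proof (induction k)
    case (Suc k)
    then have "c (a + int (2 * k)) = d (a + int (2 * k) + 1)"
      using backward[of "2 * k"] by simp
    also have "\<dots> = c (a + int (2 * Suc k))"
      using chain[OF a, of "2 * k + 1"] Suc.prems n by (auto simp: algebra_simps elim: oddE)
    finally show ?case using Suc by simp
  qed simp
  from this[of "(n - 1) div 2"] have "c (a + int (n - 1)) = c a" using n by simp
  then show False using proper[of "a + int (n - 1)"] n0 pc[of a] by (simp add: of_nat_diff)
qed

section \<open>Colorings of the sun graph\<close>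

text \<open>Also known as the sunlet graph: the pendant vertex at \<open>Inl i\<close> is
  \<open>Inr (i, 0)\<close>, where 0 is the only vertex of \<open>complete_graph 1\<close>.\<close>

definition sun :: "nat \<Rightarrow> (nat + nat \<times> nat) pair_pre_digraph" where
  "sun n = corona (cycle_graph n) (complete_graph 1)"

lemma verts_sun: "pverts (sun n) = Inl ` {0..<n} \<union> (\<lambda>i. Inr (i, 0)) ` {0..<n}"
  by (auto simp: sun_def corona_def cycle_graph_def complete_graph_def)

lemma proper_coloring_sun:
  "proper_coloring (sun n) k c \<longleftrightarrow>
     c \<in> pverts (sun n) \<rightarrow>\<^sub>E {1..k} \<and>
     (\<forall>i<n. c (Inl i) \<noteq> c (Inl (Suc i mod n)) \<and> c (Inl i) \<noteq> c (Inr (i, 0)))"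
proof -
  have Suc: "Suc i mod n < n" if "i < n" for i
    using that by (cases n) auto
  have ends: "arcs_ends (with_proj (sun n)) =
      (\<lambda>i. (Inl i, Inl (Suc i mod n))) ` {..<n} \<union> (\<lambda>i. (Inl (Suc i mod n), Inl i)) ` {..<n} \<union>
      (\<lambda>i. (Inl i, Inr (i, 0))) ` {..<n} \<union> (\<lambda>i. (Inr (i, 0), Inl i)) ` {..<n}"
    using Suc by (auto simp: sun_def corona_def cycle_graph_def complete_graph_def arcs_ends_def
        arc_to_ends_def)
  have "(\<forall>(u, v)\<in>arcs_ends (with_proj (sun n)). c u \<noteq> c v) \<longleftrightarrow>
      (\<forall>i<n. c (Inl i) \<noteq> c (Inl (Suc i mod n)) \<and> c (Inl i) \<noteq> c (Inr (i, 0)))"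
    unfolding ends by (auto simp: ball_Un)
  then show ?thesis
    by (simp add: proper_coloring_def)
qed

lemma proper_coloring_induce_subgraph:
  assumes "proper_coloring G k c" "S \<subseteq> verts G"
  shows "proper_coloring (G \<restriction> S) k (restrict c S)"
proof -
  have "(u, v) \<in> arcs_ends G \<and> u \<in> S \<and> v \<in> S" if "(u, v) \<in> arcs_ends (G \<restriction> S)" for u v
    using that by (auto simp: arcs_ends_def arc_to_ends_def induce_subgraph_def)
  then have "restrict c S u \<noteq> restrict c S v" if "(u, v) \<in> arcs_ends (G \<restriction> S)" for u v
    using assms(1) that unfolding proper_coloring_def by fastforce
  moreover have "restrict c S \<in> verts (G \<restriction> S) \<rightarrow>\<^sub>E {1..k}"
    using assms by (auto simp: proper_coloring_def)
  ultimately show ?thesis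
    unfolding proper_coloring_def by blast
qed

text \<open>\<open>f\<close> colors the cycle and \<open>p\<close> the pendant vertices; the
  restriction makes the function extensional, as \<open>proper_coloring\<close> demands.\<close>

definition sun_coloring :: "nat \<Rightarrow> (nat \<Rightarrow> nat) \<Rightarrow> (nat \<Rightarrow> nat) \<Rightarrow> nat + nat \<times> nat \<Rightarrow> nat" where
  "sun_coloring n f p = (\<lambda>x\<in>pverts (sun n). case x of Inl i \<Rightarrow> f i | Inr y \<Rightarrow> p (fst y))"

lemma sun_coloring_simps [simp]:
  "i < n \<Longrightarrow> sun_coloring n f p (Inl i) = f i"
  "i < n \<Longrightarrow> sun_coloring n f p (Inr (i, 0)) = p i"
  by (auto simp: sun_coloring_def verts_sun)

lemma proper_sun_coloring:
  assumes "\<And>i. i < n \<Longrightarrow> f i \<in> {1..k} \<and> p i \<in> {1..k} \<and> f i \<noteq> f (Suc i mod n) \<and> f i \<noteq> p i"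
  shows "proper_coloring (sun n) k (sun_coloring n f p)"
proof -
  have "Suc i mod n < n" if "i < n" for i
    using that by (cases n) auto
  moreover have "sun_coloring n f p \<in> pverts (sun n) \<rightarrow>\<^sub>E {1..k}"
    using assms by (fastforce simp: sun_coloring_def verts_sun)
  ultimately show ?thesis
    using assms by (simp add: proper_coloring_sun)
qed

lemma sun_coloring_eqI:
  assumes "proper_coloring (sun n) k c" "proper_coloring (sun n) k c'"
    "\<And>i. i < n \<Longrightarrow> c (Inl i) = c' (Inl i)" "\<And>i. i < n \<Longrightarrow> c (Inr (i, 0)) = c' (Inr (i, 0))"
  shows "c = c'"
proof (rule PiE_ext)
  show "c \<in> pverts (sun n) \<rightarrow>\<^sub>E {1..k}" "c' \<in> pverts (sun n) \<rightarrow>\<^sub>E {1..k}"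
    using assms by (simp_all add: proper_coloring_sun)
qed (use assms(3,4) in \<open>auto simp: verts_sun\<close>)

lemma proper_sun_range:
  assumes "proper_coloring (sun n) k c" "i < n"
  shows "c (Inl i) \<in> {1..k}" "c (Inr (i, 0)) \<in> {1..k}"
proof -
  have "c \<in> pverts (sun n) \<rightarrow>\<^sub>E {1..k}" "Inl i \<in> pverts (sun n)" "Inr (i, 0) \<in> pverts (sun n)"
    using assms by (simp_all add: proper_coloring_sun verts_sun)
  then show "c (Inl i) \<in> {1..k}" "c (Inr (i, 0)) \<in> {1..k}" by blast+
qed

lemma proper_sun_Suc:
  assumes "proper_coloring (sun n) k c" "Suc i < n"
  shows "c (Inl i) \<noteq> c (Inl (Suc i))"
proof -
  have "c (Inl i) \<noteq> c (Inl (Suc i mod n))"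
    using assms(1) Suc_lessD[OF assms(2)] unfolding proper_coloring_sun by blast
  then show ?thesis using assms(2) by simp
qed

text \<open>Within the colors 1 and 2, the color other than \<open>x\<close> is
  \<open>3 - x\<close>, so colors alternate along the cycle. This gives uniqueness for even
  \<open>n\<close> and excludes fewer than three colors for odd \<open>n\<close>.\<close>

lemma two_coloring_sun_parity:
  assumes c: "proper_coloring (sun n) k c" and k: "k \<le> 2" and i: "i < n"
  shows "c (Inl i) = (if even i then c (Inl 0) else 3 - c (Inl 0))"
  using i
proof (induction i)
  case (Suc i)
  then show ?case
    using proper_sun_range[OF c, of i] proper_sun_range[OF c, of "Suc i"]
      proper_sun_range[OF c, of 0] proper_sun_Suc[OF c, of i] k
    by (auto split: if_splits)
qed simp

section \<open>Even cycles\<close>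

lemma even_sun_two_coloring:
  assumes "even n" "a \<in> {1, 2}"
  shows "proper_coloring (sun n) 2 (sun_coloring n (\<lambda>i. if even i then a else 3 - a)
           (\<lambda>i. if even i then 3 - a else a))"
proof (rule proper_sun_coloring)
  fix i assume "i < n"
  \<comment> \<open>Reduction modulo an even \<open>n\<close> preserves parity, so the closing edge
    is properly colored as well.\<close>
  have "even (Suc i mod n) \<longleftrightarrow> odd i"
    using assms by (simp add: dvd_mod_iff)
  then show "(if even i then a else 3 - a) \<in> {1..2} \<and> (if even i then 3 - a else a) \<in> {1..2} \<and>
      (if even i then a else 3 - a) \<noteq> (if even (Suc i mod n) then a else 3 - a) \<and>
      (if even i then a else 3 - a) \<noteq> (if even i then 3 - a else a)"
    using assms by auto
qed

lemma chromatic_number_even_sun: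
  assumes "n \<ge> 3" "even n"
  shows "chromatic_number (sun n) = 2"
  unfolding chromatic_number_def
proof (rule Least_equality)
  show "\<exists>c. proper_coloring (sun n) 2 c"
    using even_sun_two_coloring[of n 1] assms by auto
next
  fix k assume "\<exists>c. proper_coloring (sun n) k c"
  then obtain c where c: "proper_coloring (sun n) k c" by blast
  show "2 \<le> k"
    using proper_sun_range[OF c, of 0] proper_sun_range[OF c, of 1] proper_sun_Suc[OF c, of 0] assms
    by auto
qed

lemma sudoku_number_even_sun:
  assumes n: "n \<ge> 3" "even n"
  shows "sudoku_number (sun n) = 1"
  unfolding sudoku_number_def
proof (rule Least_equality)
  let ?col = "\<lambda>a. sun_coloring n (\<lambda>i. if even i then a else 3 - a) (\<lambda>i. if even i then 3 - a else a)"
  have chi: "chromatic_number (sun n) = 2" using chromatic_number_even_sun n by blast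
  have col: "proper_coloring (sun n) 2 (?col 1)" "proper_coloring (sun n) 2 (?col 2)"
    using even_sun_two_coloring n by auto
  show "\<exists>S\<subseteq>verts (with_proj (sun n)). card S = 1 \<and> (\<exists>c0. sudoku_coloring (sun n) S c0)"
  proof (intro exI conjI)
    show S: "{Inl 0} \<subseteq> verts (with_proj (sun n))" using n by (auto simp: verts_sun)
    show "card {Inl 0} = 1" by simp
    have "c = ?col 1" if "extension (sun n) {Inl 0} (restrict (?col 1) {Inl 0}) c" for c
    proof (rule sun_coloring_eqI[OF _ col(1)])
      show c: "proper_coloring (sun n) 2 c" using that chi by (simp add: extension_def)
      have 0: "c (Inl 0) = 1" using that n by (simp add: extension_def)
      show Inl: "c (Inl i) = ?col 1 (Inl i)" if "i < n" for i
        using two_coloring_sun_parity[OF c order.refl that] 0 that by auto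
      show "c (Inr (i, 0)) = ?col 1 (Inr (i, 0))" if "i < n" for i
      proof -
        have "c (Inl i) \<noteq> c (Inr (i, 0))" using c that by (simp add: proper_coloring_sun)
        then show ?thesis using Inl[OF that] proper_sun_range[OF c that] that
          by (auto split: if_splits)
      qed
    qed
    moreover have "extension (sun n) {Inl 0} (restrict (?col 1) {Inl 0}) (?col 1)"
      using col chi by (simp add: extension_def)
    ultimately show "sudoku_coloring (sun n) {Inl 0} (restrict (?col 1) {Inl 0})"
      unfolding sudoku_coloring_def chi
      using proper_coloring_induce_subgraph[OF col(1) S] by blast
  qed
  fix m assume "\<exists>S\<subseteq>verts (with_proj (sun n)). card S = m \<and> (\<exists>c0. sudoku_coloring (sun n) S c0)"
  then obtain S c0 where S: "S \<subseteq> pverts (sun n)" "card S = m" "sudoku_coloring (sun n) S c0"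
    by auto
  show "1 \<le> m"
  proof (rule ccontr)
    assume "\<not> 1 \<le> m"
    moreover have "finite S" using S(1) by (rule finite_subset) (simp add: verts_sun)
    ultimately have "S = {}" using S(2) by (simp add: not_le)
    \<comment> \<open>With nothing prescribed, both 2-colorings are extensions.\<close>
    then have "?col 1 = ?col 2"
      using S(3) col by (auto simp: sudoku_coloring_def extension_def chi)
    then have "?col 1 (Inl 0) = ?col 2 (Inl 0)" by simp
    then show False using n by simp
  qed
qed

section \<open>Odd cycles\<close>

text \<open>
  The color missing at the cycle vertex \<open>i\<close> and its pendant vertex is the color of \<open>i - 1\<close>, for
  \<open>i > 0\<close>.
\<close>

definition odd_sun_coloring :: "nat \<Rightarrow> nat + nat \<times> nat \<Rightarrow> nat" where
  "odd_sun_coloring n = sun_coloring n (\<lambda>i. if i = 0 then 3 else if odd i then 1 else 2)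
     (\<lambda>i. if i = 0 then 1 else if i = 1 then 2 else 3)"

text \<open>The third color occurs on the cycle only at 0; the path from 1 to \<open>n - 1\<close>
  alternates between 1 and 2.\<close>

lemma proper_odd_sun_coloring:
  assumes "n \<ge> 3" "odd n"
  shows "proper_coloring (sun n) 3 (odd_sun_coloring n)"
  unfolding odd_sun_coloring_def
proof (rule proper_sun_coloring)
  fix i assume i: "i < n"
  show "(if i = 0 then 3 else if odd i then 1 else 2) \<in> {1..3::nat} \<and>
    (if i = 0 then 1 else if i = 1 then 2 else 3) \<in> {1..3::nat} \<and>
    (if i = 0 then 3 else if odd i then 1 else 2) \<noteq>
      (if Suc i mod n = 0 then 3 else if odd (Suc i mod n) then 1 else 2::nat) \<and>
    (if i = 0 then 3 else if odd i then 1 else 2) \<noteq> (if i = 0 then 1 else if i = 1 then 2 else 3::nat)"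
    using i assms by (cases "Suc i = n") auto
qed

lemma chromatic_number_odd_sun:
  assumes n: "n \<ge> 3" "odd n"
  shows "chromatic_number (sun n) = 3"
  unfolding chromatic_number_def
proof (rule Least_equality)
  show "\<exists>c. proper_coloring (sun n) 3 c"
    using proper_odd_sun_coloring n by auto
next
  fix k assume "\<exists>c. proper_coloring (sun n) k c"
  then obtain c where c: "proper_coloring (sun n) k c" by blast
  show "3 \<le> k"
  proof (rule ccontr)
    assume "\<not> 3 \<le> k"
    \<comment> \<open>\<open>n - 1\<close> is even, so alternation gives the ends of the closing
      edge the same color.\<close>
    then have "c (Inl (n - 1)) = c (Inl 0)"
      using two_coloring_sun_parity[OF c, of "n - 1"] n by simp
    moreover have "c (Inl (n - 1)) \<noteq> c (Inl (Suc (n - 1) mod n))"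
      using c n unfolding proper_coloring_sun by (meson diff_less less_le_trans zero_less_numeral zero_less_one)
    ultimately show False using n by simp
  qed
qed

lemma sudoku_odd_sun_pendant:
  assumes n: "n \<ge> 3" "odd n" and S: "sudoku_coloring (sun n) S c0" and i: "i < n"
  shows "Inr (i, 0) \<in> S"
proof (rule ccontr)
  assume notin: "Inr (i, 0) \<notin> S"
  have chi: "chromatic_number (sun n) = 3" using chromatic_number_odd_sun n by blast
  obtain c where c: "extension (sun n) S c0 c"
    and uniq: "\<And>c'. extension (sun n) S c0 c' \<Longrightarrow> c' = c"
    using S unfolding sudoku_coloring_def by blast
  have pc: "proper_coloring (sun n) 3 c" using c chi by (simp add: extension_def)
  \<comment> \<open>A pendant vertex has one neighbor; a color other than its own and that of the
    neighbor yields a second extension.\<close>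
  have "card {c (Inl i), c (Inr (i, 0))} < card {1..3::nat}"
    by (rule le_less_trans[OF card_insert_le_m1]) auto
  then obtain x where x: "x \<in> {1..3::nat}" "x \<noteq> c (Inl i)" "x \<noteq> c (Inr (i, 0))"
    by (metis card_mono finite.emptyI finite_insert insertCI leD subsetI)
  have "proper_coloring (sun n) 3 (c(Inr (i, 0) := x))"
    using pc x i by (auto simp: proper_coloring_sun PiE_iff verts_sun extensional_def)
  then have "extension (sun n) S c0 (c(Inr (i, 0) := x))"
    using c notin chi by (auto simp: extension_def)
  then show False using uniq x(3) by (metis fun_upd_same)
qed

lemma sudoku_odd_sun_cycle_vertex:
  assumes n: "n \<ge> 3" "odd n" and S: "S \<subseteq> pverts (sun n)" "sudoku_coloring (sun n) S c0"
  shows "\<exists>i<n. Inl i \<in> S"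
proof (rule ccontr)
  assume "\<not> ?thesis"
  then have SR: "S \<subseteq> (\<lambda>i. Inr (i, 0)) ` {0..<n}" using S(1) by (auto simp: verts_sun)
  have chi: "chromatic_number (sun n) = 3" using chromatic_number_odd_sun n by blast
  obtain c where c: "extension (sun n) S c0 c"
    and uniq: "\<And>c'. extension (sun n) S c0 c' \<Longrightarrow> c' = c"
    using S unfolding sudoku_coloring_def by blast
  have pc: "proper_coloring (sun n) 3 c" using c chi by (simp add: extension_def)
  define f where "f i = c (Inl (nat (i mod int n)))" for i
  define p where "p i = c (Inr (nat (i mod int n), 0))" for i
  \<comment> \<open>The three colors sum to 6, so \<open>d i\<close> is the third color. With the
    pendant colors of \<open>c\<close> kept, the list at \<open>i\<close> is
    \<open>{f i, d i}\<close>.\<close>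
  define d where "d i = 6 - f i - p i" for i
  have lt: "nat (i mod int n) < n" for i using n by (simp add: nat_less_iff)
  have rng: "f i \<in> {1..3}" "p i \<in> {1..3}" "f i \<noteq> p i" for i
    using proper_sun_range[OF pc lt] pc lt by (auto simp: f_def p_def proper_coloring_sun)
  have d: "d i \<in> {1..3}" "d i \<noteq> f i" "d i \<noteq> p i" for i
    using rng[of i] unfolding d_def atLeastAtMost_iff by presburger+
  have proper: "f i \<noteq> f (i + 1)" for i
  proof -
    have "int (Suc (nat (i mod int n)) mod n) = (i + 1) mod int n"
      using n by (simp add: zmod_int mod_simps add.commute)
    then have "nat ((i + 1) mod int n) = Suc (nat (i mod int n)) mod n" by linarith
    then show ?thesis using pc lt by (simp add: f_def proper_coloring_sun)
  qed
  have "\<exists>e. e \<noteq> f \<and> (\<forall>i. e (i + int n) = e i) \<and> (\<forall>i. e i \<in> {f i, d i}) \<and> (\<forall>i. e i \<noteq> e (i + 1))"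
  proof (rule odd_cycle_not_unique_2_list_coloring[OF n(2)])
    show "f (i + int n) = f i" "d (i + int n) = d i" for i
      by (simp_all add: f_def p_def d_def)
  qed (use proper d in \<open>auto simp: eq_commute\<close>)
  then obtain e where e: "e \<noteq> f" "\<And>i. e (i + int n) = e i" "\<And>i. e i \<in> {f i, d i}"
    "\<And>i. e i \<noteq> e (i + 1)" by blast
  \<comment> \<open>Only cycle vertices are recolored, and \<open>S\<close> contains none, so
    \<open>c'\<close> still extends \<open>c0\<close>.\<close>
  define c' where "c' = sun_coloring n (\<lambda>i. e (int i)) (\<lambda>i. c (Inr (i, 0)))"
  have "proper_coloring (sun n) 3 c'"
    unfolding c'_def
  proof (rule proper_sun_coloring)
    fix i assume i: "i < n"
    have "e (int (Suc i mod n)) = e (int i + 1)"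
      using periodic_mod[of e "int n" "int i + 1"] e(2) by (simp add: zmod_int add.commute)
    moreover have "p (int i) = c (Inr (i, 0))" using i by (simp add: p_def)
    ultimately show "e (int i) \<in> {1..3} \<and> c (Inr (i, 0)) \<in> {1..3} \<and>
        e (int i) \<noteq> e (int (Suc i mod n)) \<and> e (int i) \<noteq> c (Inr (i, 0))"
      using e(3)[of "int i"] e(4)[of "int i"] rng[of "int i"] d[of "int i"] by auto
  qed
  moreover have "c' v = c0 v" if "v \<in> S" for v
    using SR that c by (auto simp: c'_def extension_def)
  ultimately have "c' = c" using uniq chi by (simp add: extension_def)
  have "e i = f i" for i
  proof -
    have "e i = e (i mod int n)" using periodic_mod[of e] e(2) by simp
    also have "\<dots> = c' (Inl (nat (i mod int n)))" using lt n by (simp add: c'_def)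
    finally show ?thesis using \<open>c' = c\<close> by (simp add: f_def)
  qed
  then show False using e(1) by auto
qed

lemma sudoku_number_odd_sun:
  assumes n: "n \<ge> 3" "odd n"
  shows "sudoku_number (sun n) = n + 1"
  unfolding sudoku_number_def
proof (rule Least_equality)
  have chi: "chromatic_number (sun n) = 3" using chromatic_number_odd_sun n by blast
  let ?col = "odd_sun_coloring n"
  have col: "proper_coloring (sun n) 3 ?col" using proper_odd_sun_coloring n by blast
  let ?P = "(\<lambda>i. Inr (i, 0)) ` {0..<n} :: (nat + nat \<times> nat) set"
  have cardP: "card ?P = n" by (subst card_image) (auto simp: inj_on_def)
  show "\<exists>S\<subseteq>verts (with_proj (sun n)). card S = n + 1 \<and> (\<exists>c0. sudoku_coloring (sun n) S c0)"
  proof (intro exI conjI)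
    let ?S = "insert (Inl 0) ?P"
    show S: "?S \<subseteq> verts (with_proj (sun n))" using n by (auto simp: verts_sun)
    show "card ?S = n + 1" using cardP by (subst card_insert_disjoint) auto
    have "c = ?col" if "extension (sun n) ?S (restrict ?col ?S) c" for c
    proof (rule sun_coloring_eqI[OF _ col])
      show c: "proper_coloring (sun n) 3 c" using that chi by (simp add: extension_def)
      have 0: "c (Inl 0) = ?col (Inl 0)" using that by (simp add: extension_def)
      show Inr: "c (Inr (i, 0)) = ?col (Inr (i, 0))" if "i < n" for i
        using \<open>extension (sun n) ?S (restrict ?col ?S) c\<close> that by (simp add: extension_def)
      show "c (Inl i) = ?col (Inl i)" if "i < n" for i
        using that
      proof (induction i)
        case (Suc i)
        \<comment> \<open>The pendant color here differs from the color already forced at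
          \<open>i\<close>, so exactly one of the three colors remains.\<close>
        have "c (Inl (Suc i)) \<noteq> c (Inr (Suc i, 0))"
          using c Suc.prems by (simp add: proper_coloring_sun)
        then show ?case
          using Suc Inr[of "Suc i"] proper_sun_Suc[OF c Suc.prems] proper_sun_range(1)[OF c Suc.prems]
          by (auto simp: odd_sun_coloring_def split: if_splits)
      qed (rule 0)
    qed
    moreover have "extension (sun n) ?S (restrict ?col ?S) ?col"
      using col chi by (simp add: extension_def)
    ultimately show "sudoku_coloring (sun n) ?S (restrict ?col ?S)"
      unfolding sudoku_coloring_def chi
      using proper_coloring_induce_subgraph[OF col S] by blast
  qed
  fix m assume "\<exists>S\<subseteq>verts (with_proj (sun n)). card S = m \<and> (\<exists>c0. sudoku_coloring (sun n) S c0)"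
  then obtain S c0 where S: "S \<subseteq> pverts (sun n)" "card S = m" "sudoku_coloring (sun n) S c0"
    by auto
  obtain i where "Inl i \<in> S" using sudoku_odd_sun_cycle_vertex[OF n S(1,3)] by blast
  then have "insert (Inl i) ?P \<subseteq> S" using sudoku_odd_sun_pendant[OF n S(3)] by auto
  moreover have "finite S" using S(1) by (rule finite_subset) (simp add: verts_sun)
  ultimately have "card (insert (Inl i) ?P) \<le> m" using S(2) card_mono by blast
  moreover have "card (insert (Inl i) ?P) = n + 1"
    using cardP by (subst card_insert_disjoint) auto
  ultimately show "n + 1 \<le> m" by simp
qed

theorem theorem2p2:
  fixes n :: nat
  assumes "n \<ge> 3"
  shows "sudoku_number (corona (cycle_graph n) (complete_graph 1)) = (if even n then 1 else n + 1)"
  using assms sudoku_number_even_sun sudoku_number_odd_sun by (simp add: sun_def)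

end
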